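(* For every integer $k\ge1$ there is a constant $\beta_{2,k,\max}>0$, depending only on $k$, such that the following holds. Consider the linear equation $u_t=Au_{xx}$ with constant $A>0$ and periodic boundary conditions on $[a,b]$, and the time-semi-discrete scheme obtained from forward Euler time stepping with step $\Delta t$ combined with the $k$-term kernel-based approximation of $Au_{xx}$ with parameter $\alpha=\sqrt{\beta/(A\Delta t)}$, that is, $$u^{n+1}=u^n+\Delta t\,A\,\frac{\alpha^2}{4}\left(\sum_{p=1}^{k}\mathcal{D}_0^{\,p-1}(\mathcal{D}_L-\mathcal{D}_R)\right)^{2}[u^n,\alpha].$$ If $0<\beta\le\beta_{2,k,\max}$, then the scheme is A-stable. For $k=1,2,3$ the constants are $$\beta_{2,1,\max}=8,\qquad \beta_{2,2,\max}=3.2275,\qquad \beta_{2,3,\max}=1.9800.$$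
   Context: Fix an interval $[a,b]$ and $\alpha>0$, and put $\mu=e^{-\alpha(b-a)}$. For a continuous (complex-valued) function $v$ on $[a,b]$ define $$I^{L}[v,\alpha](x)=\alpha\int_a^x e^{-\alpha(x-y)}v(y)\,dy,\qquad I^{R}[v,\alpha](x)=\alpha\int_x^b e^{-\alpha(y-x)}v(y)\,dy,$$ $$\mathcal{L}_L^{-1}[v,\alpha](x)=I^L[v,\alpha](x)+\frac{I^L[v,\alpha](b)}{1-\mu}e^{-\alpha(x-a)},\qquad \mathcal{L}_R^{-1}[v,\alpha](x)=I^R[v,\alpha](x)+\frac{I^R[v,\alpha](a)}{1-\mu}e^{-\alpha(b-x)}.$$ These are the inverses of $\mathcal{L}_L=\mathcal{I}+\frac1\alpha\partial_x$ and $\mathcal{L}_R=\mathcal{I}-\frac1\alpha\partial_x$ ($\mathcal{I}$ the identity) normalized so that the output takes equal values at $a$ and $b$. Define $$\mathcal{D}_L=\mathcal{I}-\mathcal{L}_L^{-1},\qquad \mathcal{D}_R=\mathcal{I}-\mathcal{L}_R^{-1},\qquad \mathcal{D}_0=\tfrac12(\mathcal{D}_L+\mathcal{D}_R).$$ Powers and products of these operators denote composition (all with the same parameter $\alpha$), and $\mathcal{D}_0^{0}=\mathcal{I}$. The integrals are evaluated exactly (no spatial discretization). A-stability is meant in the von Neumann sense, unconditionally in the time step: for every $\Delta t>0$, every $A>0$ and every Fourier mode $u^n(x)=\hat u\,e^{i\eta x}$ that is $(b-a)$-periodic (i.e. $\eta\in\frac{2\pi}{b-a}\mathbb{Z}$),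 one has $u^{n+1}=\hat Q\,u^n$ with an amplification factor $\hat Q$ satisfying $|\hat Q|\le1$.
   Formalization: The constants 3.2275 (k=2) and 1.9800 (k=3) slightly exceed the true thresholds 3.22745 and 1.97999, so stability fails at them; here the constants are the sharp thresholds, shown to be within 0.0001 and 0.00005 of the printed values. *)

theory Defs
  imports "HOL-Analysis.Analysis"
begin

(* Functions on [a,b] are represented by functions real => complex. For x in [a,b],
   every operator below depends only on the values of its argument on [a,b]. *)

definition IL :: "real \<Rightarrow> real \<Rightarrow> (real \<Rightarrow> complex) \<Rightarrow> real \<Rightarrow> complex" where
  "IL a \<alpha> v x = of_real \<alpha> * integral {a..x} (\<lambda>y. of_real (exp (- \<alpha> * (x - y))) * v y)"

definition IR :: "real \<Rightarrow> real \<Rightarrow> (real \<Rightarrow> complex) \<Rightarrow> real \<Rightarrow> complex" where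
  "IR b \<alpha> v x = of_real \<alpha> * integral {x..b} (\<lambda>y. of_real (exp (- \<alpha> * (y - x))) * v y)"

definition mu :: "real \<Rightarrow> real \<Rightarrow> real \<Rightarrow> real" where
  "mu a b \<alpha> = exp (- \<alpha> * (b - a))"

definition LL_inv :: "real \<Rightarrow> real \<Rightarrow> real \<Rightarrow> (real \<Rightarrow> complex) \<Rightarrow> real \<Rightarrow> complex" where
  "LL_inv a b \<alpha> v x =
     IL a \<alpha> v x + IL a \<alpha> v b / of_real (1 - mu a b \<alpha>) * of_real (exp (- \<alpha> * (x - a)))"

definition LR_inv :: "real \<Rightarrow> real \<Rightarrow> real \<Rightarrow> (real \<Rightarrow> complex) \<Rightarrow> real \<Rightarrow> complex" where
  "LR_inv a b \<alpha> v x =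
     IR b \<alpha> v x + IR b \<alpha> v a / of_real (1 - mu a b \<alpha>) * of_real (exp (- \<alpha> * (b - x)))"

definition DL :: "real \<Rightarrow> real \<Rightarrow> real \<Rightarrow> (real \<Rightarrow> complex) \<Rightarrow> real \<Rightarrow> complex" where
  "DL a b \<alpha> v x = v x - LL_inv a b \<alpha> v x"

definition DR :: "real \<Rightarrow> real \<Rightarrow> real \<Rightarrow> (real \<Rightarrow> complex) \<Rightarrow> real \<Rightarrow> complex" where
  "DR a b \<alpha> v x = v x - LR_inv a b \<alpha> v x"

definition D0 :: "real \<Rightarrow> real \<Rightarrow> real \<Rightarrow> (real \<Rightarrow> complex) \<Rightarrow> real \<Rightarrow> complex" where
  "D0 a b \<alpha> v x = (DL a b \<alpha> v x + DR a b \<alpha> v x) / 2"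

definition kernel_sum :: "nat \<Rightarrow> real \<Rightarrow> real \<Rightarrow> real \<Rightarrow> (real \<Rightarrow> complex) \<Rightarrow> real \<Rightarrow> complex" where
  "kernel_sum k a b \<alpha> v x =
     (\<Sum>p = 1..k. (D0 a b \<alpha> ^^ (p - 1)) (\<lambda>y. DL a b \<alpha> v y - DR a b \<alpha> v y) x)"

definition euler_step ::
  "nat \<Rightarrow> real \<Rightarrow> real \<Rightarrow> real \<Rightarrow> real \<Rightarrow> real \<Rightarrow> (real \<Rightarrow> complex) \<Rightarrow> real \<Rightarrow> complex" where
  "euler_step k a b \<beta> A dt u x =
     (let \<alpha> = sqrt (\<beta> / (A * dt)) in
      u x + of_real (dt * A * (\<alpha>\<^sup>2 / 4)) * (kernel_sum k a b \<alpha> ^^ 2) u x)"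

(* The amplification factor Q may depend on dt, A and the frequency, but not on the
   amplitude c; quantifying c inside keeps the zero amplitude from trivializing Q. *)
definition A_stable :: "nat \<Rightarrow> real \<Rightarrow> real \<Rightarrow> real \<Rightarrow> bool" where
  "A_stable k a b \<beta> \<longleftrightarrow>
     (\<forall>dt A \<eta>. dt > 0 \<longrightarrow> A > 0 \<longrightarrow> (\<exists>m::int. \<eta> = 2 * pi / (b - a) * of_int m) \<longrightarrow>
       (\<exists>Q::complex. norm Q \<le> 1 \<and>
         (\<forall>(c::complex). \<forall>x\<in>{a..b}.
            euler_step k a b \<beta> A dt (\<lambda>y. c * exp (\<i> * of_real (\<eta> * y))) x
              = Q * (c * exp (\<i> * of_real (\<eta> * x))))))"

end

theory Submission
  imports Defs
begin

text \<open>On a periodic Fourier mode of frequency \<open>\<eta>\<close> all operators act as multipliers. With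
  \<open>s = \<eta>\<^sup>2 / (\<alpha>\<^sup>2 + \<eta>\<^sup>2)\<close>, the multiplier of \<open>D\<^sub>0\<close> is \<open>s\<close> and the square of the multiplier of
  \<open>D\<^sub>L - D\<^sub>R\<close> is \<open>-4 s (1 - s)\<close>, so the amplification factor is
  \<open>1 - \<beta> s (1 - s) (1 + s + \<dots> + s^(k-1))\<^sup>2\<close>. Varying the time step, \<open>s\<close> takes every value in
  \<open>(0,1)\<close> for a fixed nonzero frequency; hence the sharp bound for \<open>\<beta>\<close> is \<open>2\<close> divided by the
  maximum over \<open>[0,1]\<close> of the polynomial multiplying \<open>\<beta>\<close>.\<close>

section \<open>Fourier modes and the one-sided exponential integrals of a mode\<close>

definition mode :: "complex \<Rightarrow> real \<Rightarrow> real \<Rightarrow> complex" where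
  "mode c \<eta> y = c * exp (\<i> * of_real (\<eta> * y))"

lemma mode_periodic:
  assumes "a < b" "\<eta> = 2 * pi / (b - a) * of_int m"
  shows "mode c \<eta> b = mode c \<eta> a"
proof -
  have "\<eta> * b = \<eta> * a + 2 * pi * of_int m"
    using assms by (simp add: field_simps)
  then have "exp (\<i> * of_real (\<eta> * b)) = exp (\<i> * of_real (\<eta> * a))"
    unfolding exp_eq by (intro exI[of _ m]) (simp add: algebra_simps)
  then show ?thesis
    by (simp add: mode_def)
qed

lemma integral_cexp:
  fixes w :: complex
  assumes "w \<noteq> 0" "p \<le> q"
  shows "integral {p..q} (\<lambda>y. exp (w * of_real y))
    = (exp (w * of_real q) - exp (w * of_real p)) / w"
proof -
  have "((\<lambda>y. exp (w * of_real y)) has_integral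
      (exp (w * of_real q) / w - exp (w * of_real p) / w)) {p..q}"
  proof (intro fundamental_theorem_of_calculus[OF assms(2)])
    fix y :: real
    have "((\<lambda>z. exp (w * z) / w) has_field_derivative exp (w * of_real y)) (at (of_real y))"
      using assms(1) by (auto intro!: derivative_eq_intros)
    then show "((\<lambda>y. exp (w * of_real y) / w) has_vector_derivative exp (w * of_real y))
        (at y within {p..q})"
      by (rule has_vector_derivative_real_field)
  qed
  then show ?thesis
    by (simp add: integral_unique diff_divide_distrib)
qed

text \<open>The integrand is a single exponential with exponent \<open>\<alpha> + i \<eta>\<close>,
  nonzero because \<open>\<alpha> > 0\<close>. Only agreement of \<open>v\<close> with a mode on the
  interval is assumed, since operator outputs need not be modes outside
  \<open>{a..b}\<close>.\<close>

lemma IL_mode: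
  assumes "\<alpha> > 0" "x \<ge> a" "\<And>y. y \<in> {a..x} \<Longrightarrow> v y = mode c \<eta> y"
  shows "IL a \<alpha> v x = of_real \<alpha> / (of_real \<alpha> + \<i> * of_real \<eta>) *
    (mode c \<eta> x - mode c \<eta> a * of_real (exp (- \<alpha> * (x - a))))"
proof -
  define w where "w = of_real \<alpha> + \<i> * of_real \<eta>"
  have w: "w \<noteq> 0"
    using assms(1) by (auto simp: w_def complex_eq_iff)
  have "integral {a..x} (\<lambda>y. of_real (exp (- \<alpha> * (x - y))) * v y)
      = integral {a..x} (\<lambda>y. (c * exp (- of_real (\<alpha> * x))) * exp (w * of_real y))"
    using assms(3)
    by (intro integral_cong)
       (simp add: mode_def w_def exp_of_real[symmetric] exp_add[symmetric] algebra_simps)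
  also have "\<dots> = (c * exp (- of_real (\<alpha> * x))) *
      ((exp (w * of_real x) - exp (w * of_real a)) / w)"
    by (simp add: integral_cexp[OF w assms(2)])
  also have "\<dots> = (mode c \<eta> x - mode c \<eta> a * of_real (exp (- \<alpha> * (x - a)))) / w"
    by (simp add: mode_def w_def exp_of_real[symmetric] exp_add[symmetric] algebra_simps)
  finally show ?thesis
    by (simp add: IL_def w_def)
qed

lemma IR_mode:
  assumes "\<alpha> > 0" "x \<le> b" "\<And>y. y \<in> {x..b} \<Longrightarrow> v y = mode c \<eta> y"
  shows "IR b \<alpha> v x = of_real \<alpha> / (of_real \<alpha> - \<i> * of_real \<eta>) *
    (mode c \<eta> x - mode c \<eta> b * of_real (exp (- \<alpha> * (b - x))))"
proof -
  define w where "w = \<i> * of_real \<eta> - of_real \<alpha>"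
  have w: "w \<noteq> 0"
    using assms(1) by (auto simp: w_def complex_eq_iff)
  have "integral {x..b} (\<lambda>y. of_real (exp (- \<alpha> * (y - x))) * v y)
      = integral {x..b} (\<lambda>y. (c * exp (of_real (\<alpha> * x))) * exp (w * of_real y))"
    using assms(3)
    by (intro integral_cong)
       (simp add: mode_def w_def exp_of_real[symmetric] exp_add[symmetric] algebra_simps)
  also have "\<dots> = (c * exp (of_real (\<alpha> * x))) *
      ((exp (w * of_real b) - exp (w * of_real x)) / w)"
    by (simp add: integral_cexp[OF w assms(2)])
  also have "\<dots> = (mode c \<eta> b * of_real (exp (- \<alpha> * (b - x))) - mode c \<eta> x) / w"
    by (simp add: mode_def w_def exp_of_real[symmetric] exp_add[symmetric] algebra_simps)
  also have "\<dots> = (mode c \<eta> x - mode c \<eta> b * of_real (exp (- \<alpha> * (b - x)))) / (- w)"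
    by (simp add: minus_divide_right[symmetric] diff_divide_distrib)
  finally show ?thesis
    by (simp add: IR_def w_def)
qed

section \<open>Multipliers of the kernel operators on a periodic mode\<close>

locale periodic_mode =
  fixes a b \<alpha> \<eta> :: real and m :: int
  assumes ab: "a < b" and alpha_pos: "\<alpha> > 0" and eta: "\<eta> = 2 * pi / (b - a) * of_int m"
begin

lemma mu_neq_1: "complex_of_real (1 - mu a b \<alpha>) \<noteq> 0"
  using ab alpha_pos by (simp add: mu_def)

lemma denom_nonzero:
  "of_real \<alpha> + \<i> * of_real \<eta> \<noteq> 0" "of_real \<alpha> - \<i> * of_real \<eta> \<noteq> 0"
  "(of_real \<alpha>)\<^sup>2 + (of_real \<eta>)\<^sup>2 \<noteq> (0::complex)"
proof -
  show "of_real \<alpha> + \<i> * of_real \<eta> \<noteq> 0" "of_real \<alpha> - \<i> * of_real \<eta> \<noteq> 0"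
    using alpha_pos by (auto simp: complex_eq_iff)
  have "\<alpha>\<^sup>2 + \<eta>\<^sup>2 \<noteq> 0"
    using alpha_pos by (simp add: sum_power2_eq_zero_iff)
  then show "(of_real \<alpha>)\<^sup>2 + (of_real \<eta>)\<^sup>2 \<noteq> (0::complex)"
    by (metis of_real_add of_real_eq_0_iff of_real_power)
qed

text \<open>By periodicity the integral up to \<open>b\<close> carries the factor
  \<open>1 - \<mu>\<close>, so the boundary correction cancels exactly the decaying term left by
  \<open>IL_mode\<close>.\<close>

lemma LL_inv_mode:
  assumes v: "\<And>y. y \<in> {a..b} \<Longrightarrow> v y = mode c \<eta> y" and x: "x \<in> {a..b}"
  shows "LL_inv a b \<alpha> v x = of_real \<alpha> / (of_real \<alpha> + \<i> * of_real \<eta>) * mode c \<eta> x"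
proof -
  let ?r = "complex_of_real \<alpha> / (of_real \<alpha> + \<i> * of_real \<eta>)"
  have "IL a \<alpha> v b = ?r * mode c \<eta> a * of_real (1 - mu a b \<alpha>)"
    using ab v
    by (subst IL_mode[OF alpha_pos, where c = c and \<eta> = \<eta>])
       (auto simp: mode_periodic[OF ab eta] mu_def right_diff_distrib)
  then have "IL a \<alpha> v b / of_real (1 - mu a b \<alpha>) = ?r * mode c \<eta> a"
    using mu_neq_1 by simp
  moreover have "IL a \<alpha> v x = ?r * (mode c \<eta> x - mode c \<eta> a * of_real (exp (- \<alpha> * (x - a))))"
    using v x by (intro IL_mode alpha_pos) auto
  ultimately show ?thesis
    unfolding LL_inv_def by (simp only:) (simp only: ring_distribs mult.assoc diff_add_cancel)
qed

lemma LR_inv_mode: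
  assumes v: "\<And>y. y \<in> {a..b} \<Longrightarrow> v y = mode c \<eta> y" and x: "x \<in> {a..b}"
  shows "LR_inv a b \<alpha> v x = of_real \<alpha> / (of_real \<alpha> - \<i> * of_real \<eta>) * mode c \<eta> x"
proof -
  let ?r = "complex_of_real \<alpha> / (of_real \<alpha> - \<i> * of_real \<eta>)"
  have "IR b \<alpha> v a = ?r * mode c \<eta> b * of_real (1 - mu a b \<alpha>)"
    using ab v
    by (subst IR_mode[OF alpha_pos, where c = c and \<eta> = \<eta>])
       (auto simp: mode_periodic[OF ab eta] mu_def right_diff_distrib)
  then have "IR b \<alpha> v a / of_real (1 - mu a b \<alpha>) = ?r * mode c \<eta> b"
    using mu_neq_1 by simp
  moreover have "IR b \<alpha> v x = ?r * (mode c \<eta> x - mode c \<eta> b * of_real (exp (- \<alpha> * (b - x))))"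
    using v x by (intro IR_mode alpha_pos) auto
  ultimately show ?thesis
    unfolding LR_inv_def by (simp only:) (simp only: ring_distribs mult.assoc diff_add_cancel)
qed

definition s :: real where
  "s = \<eta>\<^sup>2 / (\<alpha>\<^sup>2 + \<eta>\<^sup>2)"

text \<open>This is the multiplier of \<open>DL - DR\<close> over a common denominator. It is purely
  imaginary, so its square is real and nonpositive.\<close>

definition d :: complex where
  "d = 2 * \<i> * of_real \<alpha> * of_real \<eta> / ((of_real \<alpha>)\<^sup>2 + (of_real \<eta>)\<^sup>2)"

lemma denom_factor:
  "(of_real \<alpha>)\<^sup>2 + (of_real \<eta>)\<^sup>2
    = (of_real \<alpha> + \<i> * of_real \<eta>) * (of_real \<alpha> - \<i> * of_real \<eta> :: complex)"
  by (simp add: algebra_simps power2_eq_square)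

text \<open>The multiplier is absorbed into the amplitude, so that the output is again a mode on
  \<open>{a..b}\<close> and operators can be chained.\<close>

lemma D0_mode:
  assumes "\<And>y. y \<in> {a..b} \<Longrightarrow> v y = mode c \<eta> y" "x \<in> {a..b}"
  shows "D0 a b \<alpha> v x = mode (of_real s * c) \<eta> x"
proof -
  let ?p = "of_real \<alpha> + \<i> * of_real \<eta> :: complex" and ?q = "of_real \<alpha> - \<i> * of_real \<eta> :: complex"
  have LL: "LL_inv a b \<alpha> v x = of_real \<alpha> / ?p * mode c \<eta> x"
    using assms by (rule LL_inv_mode)
  have LR: "LR_inv a b \<alpha> v x = of_real \<alpha> / ?q * mode c \<eta> x"
    using assms by (rule LR_inv_mode)
  have "complex_of_real s = 1 - (of_real \<alpha> / ?p + of_real \<alpha> / ?q) / 2"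
    using denom_nonzero
    by (simp add: s_def denom_factor divide_simps) (simp add: algebra_simps power2_eq_square)
  then show ?thesis
    unfolding D0_def DL_def DR_def LL LR assms(1)[OF assms(2)] mode_def
    by (simp only:) (simp add: algebra_simps add_divide_distrib diff_divide_distrib)
qed

lemma DL_DR_mode:
  assumes "\<And>y. y \<in> {a..b} \<Longrightarrow> v y = mode c \<eta> y" "x \<in> {a..b}"
  shows "DL a b \<alpha> v x - DR a b \<alpha> v x = mode (d * c) \<eta> x"
proof -
  let ?p = "of_real \<alpha> + \<i> * of_real \<eta> :: complex" and ?q = "of_real \<alpha> - \<i> * of_real \<eta> :: complex"
  have LL: "LL_inv a b \<alpha> v x = of_real \<alpha> / ?p * mode c \<eta> x"
    using assms by (rule LL_inv_mode)
  have LR: "LR_inv a b \<alpha> v x = of_real \<alpha> / ?q * mode c \<eta> x"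
    using assms by (rule LR_inv_mode)
  have "d = of_real \<alpha> / ?q - of_real \<alpha> / ?p"
    using denom_nonzero
    by (simp add: d_def denom_factor divide_simps) (simp add: algebra_simps power2_eq_square)
  then show ?thesis
    unfolding DL_def DR_def LL LR mode_def by (simp only:) (simp add: algebra_simps)
qed

lemma D0_funpow_mode:
  assumes "\<And>y. y \<in> {a..b} \<Longrightarrow> v y = mode c \<eta> y" "x \<in> {a..b}"
  shows "(D0 a b \<alpha> ^^ n) v x = mode (of_real s ^ n * c) \<eta> x"
  using assms(2)
proof (induction n arbitrary: x)
  case 0
  then show ?case using assms(1) by simp
next
  case (Suc n)
  then show ?case
    using D0_mode[of "(D0 a b \<alpha> ^^ n) v" "of_real s ^ n * c" x] by (simp add: mult.assoc)
qed

lemma kernel_sum_mode: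
  assumes "\<And>y. y \<in> {a..b} \<Longrightarrow> v y = mode c \<eta> y" "x \<in> {a..b}"
  shows "kernel_sum k a b \<alpha> v x = mode ((\<Sum>p<k. of_real s ^ p) * d * c) \<eta> x"
proof -
  \<comment> \<open>Shifting the index from \<open>p - 1\<close> to \<open>p\<close> makes the sum
    of multipliers the geometric sum over \<open>p < k\<close>.\<close>
  have "kernel_sum k a b \<alpha> v x
      = (\<Sum>p<k. (D0 a b \<alpha> ^^ p) (\<lambda>y. DL a b \<alpha> v y - DR a b \<alpha> v y) x)"
    by (simp add: kernel_sum_def sum.atLeast1_atMost_eq)
  also have "\<dots> = (\<Sum>p<k. mode (of_real s ^ p * (d * c)) \<eta> x)"
    using assms by (intro sum.cong D0_funpow_mode DL_DR_mode refl)
  finally show ?thesis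
    by (simp add: mode_def sum_distrib_right mult.assoc)
qed

text \<open>With \<open>1 - s = \<alpha>^2 / (\<alpha>^2 + \<eta>^2)\<close>, the product
  \<open>s (1 - s)\<close> is \<open>\<alpha>^2 \<eta>^2\<close> over the squared
  denominator.\<close>

lemma d_squared: "d\<^sup>2 = - of_real (4 * (s * (1 - s)))"
proof -
  have "complex_of_real (1 - s) = (of_real \<alpha>)\<^sup>2 / ((of_real \<alpha>)\<^sup>2 + (of_real \<eta>)\<^sup>2)"
    using denom_nonzero(3) by (simp add: s_def field_simps)
  then show ?thesis
    by (simp add: d_def s_def power_divide power_mult_distrib) (simp add: power2_eq_square)
qed

end

section \<open>The amplification factor as a real polynomial in \<open>s\<close>\<close>

definition profile :: "nat \<Rightarrow> real \<Rightarrow> real" where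
  "profile k s = s * (1 - s) * (\<Sum>p<k. s ^ p)\<^sup>2"

lemma euler_step_mode:
  assumes "a < b" "0 < \<beta>" "0 < dt" "0 < A" and \<eta>: "\<eta> = 2 * pi / (b - a) * of_int m"
    and "x \<in> {a..b}"
  defines "\<theta> \<equiv> \<beta> / (A * dt)"
  shows "euler_step k a b \<beta> A dt (mode c \<eta>) x
    = of_real (1 - \<beta> * profile k (\<eta>\<^sup>2 / (\<theta> + \<eta>\<^sup>2))) * mode c \<eta> x"
proof -
  have \<theta>: "\<theta> > 0" using assms by simp
  interpret periodic_mode a b "sqrt \<theta>" \<eta> m
    using assms \<theta> by unfold_locales auto
  have s: "s = \<eta>\<^sup>2 / (\<theta> + \<eta>\<^sup>2)"
    using \<theta> by (simp add: s_def)
  define S where "S = (\<Sum>p<k. s ^ p)"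
  have S: "(\<Sum>p<k. complex_of_real s ^ p) = of_real S"
    by (simp add: S_def)
  \<comment> \<open>The inner output is known to be a mode only on \<open>{a..b}\<close>; membership
    stays in set form to match the premises of \<open>kernel_sum_mode\<close>.\<close>
  have "(kernel_sum k a b (sqrt \<theta>) ^^ 2) (mode c \<eta>) x = mode (of_real S * d * (of_real S * d * c)) \<eta> x"
    unfolding numeral_2_eq_2 using \<open>x \<in> {a..b}\<close> by (simp add: kernel_sum_mode S del: atLeastAtMost_iff)
  also have "\<dots> = d\<^sup>2 * of_real (S\<^sup>2) * mode c \<eta> x"
    by (simp add: mode_def power2_eq_square)
  also have "\<dots> = of_real (- 4 * profile k s) * mode c \<eta> x"
    by (simp add: d_squared profile_def S_def)
  finally have K: "(kernel_sum k a b (sqrt \<theta>) ^^ 2) (mode c \<eta>) x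
    = of_real (- 4 * profile k s) * mode c \<eta> x" .
  \<comment> \<open>The choice of \<open>\<alpha>\<close> cancels \<open>dt * A\<close>, and the
    remaining \<open>1/4\<close> will cancel the 4 from \<open>d_squared\<close>.\<close>
  have "dt * A * ((sqrt \<theta>)\<^sup>2 / 4) = \<beta> / 4"
    using assms \<theta> by (simp add: \<theta>_def)
  then have "euler_step k a b \<beta> A dt (mode c \<eta>) x
    = mode c \<eta> x + of_real (\<beta> / 4) * (of_real (- 4 * profile k s) * mode c \<eta> x)"
    unfolding euler_step_def Let_def \<theta>_def[symmetric] K by simp
  then show ?thesis
    by (simp add: s algebra_simps)
qed

section \<open>Maximum of the profile and the sharp stability threshold\<close>

lemma profile_nonneg: "0 \<le> s \<Longrightarrow> s \<le> 1 \<Longrightarrow> 0 \<le> profile k s"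
  by (simp add: profile_def)

definition profile_max :: "nat \<Rightarrow> real" where
  "profile_max k = Sup (profile k ` {0..1})"

lemma continuous_on_profile: "continuous_on S (profile k)"
  unfolding profile_def by (intro continuous_intros)

lemma profile_le_profile_max:
  assumes "0 \<le> s" "s \<le> 1"
  shows "profile k s \<le> profile_max k"
proof -
  have "bdd_above (profile k ` {0..1})"
    by (intro bounded_imp_bdd_above compact_imp_bounded compact_continuous_image
        continuous_on_profile compact_Icc)
  then show ?thesis
    unfolding profile_max_def using assms by (intro cSup_upper) auto
qed

lemma profile_max_pos:
  assumes "k \<ge> 1"
  shows "0 < profile_max k"
proof -
  have "0 < (\<Sum>p<k. (1/2::real) ^ p)"
    using assms by (intro sum_pos) (auto simp: lessThan_empty_iff)
  then have "0 < profile k (1/2)"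
    by (simp add: profile_def)
  also have "\<dots> \<le> profile_max k"
    by (simp add: profile_le_profile_max)
  finally show ?thesis .
qed

text \<open>Compactness gives a maximiser; it is interior because the profile vanishes at 0 and 1
  while its maximum is positive. An interior point is what a positive time step can realise.\<close>

lemma profile_max_attained:
  assumes "k \<ge> 1"
  obtains t where "0 < t" "t < 1" "profile k t = profile_max k"
proof -
  obtain t where t: "t \<in> {0..1}" "\<And>s. s \<in> {0..1} \<Longrightarrow> profile k s \<le> profile k t"
    using continuous_attains_sup[OF compact_Icc _ continuous_on_profile, of "0::real" 1 k] by auto
  then have max: "profile k t = profile_max k"
    unfolding profile_max_def by (intro cSup_eq_maximum[symmetric]) auto
  then have "t \<noteq> 0" "t \<noteq> 1"
    using profile_max_pos[OF assms] by (auto simp: profile_def)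
  then show thesis
    using that[of t] t(1) max by auto
qed

lemma profile_max_le:
  assumes "\<And>s. 0 \<le> s \<Longrightarrow> s \<le> 1 \<Longrightarrow> profile k s \<le> U"
  shows "profile_max k \<le> U"
  unfolding profile_max_def using assms by (intro cSup_least) auto

text \<open>The amplification factor is real and at most 1, so the only constraint is that it be at
  least -1. Necessity comes from a time step that places \<open>s\<close> at the maximiser.\<close>

lemma A_stable_iff:
  assumes "k \<ge> 1" "a < b" "0 < \<beta>"
  shows "A_stable k a b \<beta> \<longleftrightarrow> \<beta> \<le> 2 / profile_max k"
proof -
  obtain t where t: "0 < t" "t < 1" "profile k t = profile_max k"
    using profile_max_attained[OF assms(1)] .
  note pos = profile_max_pos[OF assms(1)]
  show ?thesis
  proof
    assume \<beta>: "\<beta> \<le> 2 / profile_max k"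
    show "A_stable k a b \<beta>"
      unfolding A_stable_def
    proof (intro allI impI)
      fix dt A \<eta> :: real
      assume *: "dt > 0" "A > 0" and "\<exists>m::int. \<eta> = 2 * pi / (b - a) * of_int m"
      then obtain m :: int where m: "\<eta> = 2 * pi / (b - a) * of_int m"
        by blast
      define s where "s = \<eta>\<^sup>2 / (\<beta> / (A * dt) + \<eta>\<^sup>2)"
      have "\<beta> / (A * dt) > 0" using * assms by simp
      then have s: "0 \<le> s" "s \<le> 1"
        by (auto simp: s_def divide_le_eq_1 add_pos_nonneg)
      have "\<beta> * profile k s \<le> \<beta> * profile_max k"
        using profile_le_profile_max[OF s] assms by simp
      also have "\<dots> \<le> 2"
        using \<beta> pos by (simp add: field_simps)
      finally have "\<bar>1 - \<beta> * profile k s\<bar> \<le> 1"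
        using profile_nonneg[OF s, of k] assms by (simp add: abs_le_iff)
      then have "norm (complex_of_real (1 - \<beta> * profile k s)) \<le> 1"
        by (simp only: norm_of_real)
      moreover have "\<forall>c. \<forall>x\<in>{a..b}. euler_step k a b \<beta> A dt (mode c \<eta>) x
          = of_real (1 - \<beta> * profile k s) * mode c \<eta> x"
        using euler_step_mode[OF assms(2,3) *(1,2) m] unfolding s_def by blast
      ultimately show "\<exists>Q. norm Q \<le> 1 \<and> (\<forall>c. \<forall>x\<in>{a..b}.
          euler_step k a b \<beta> A dt (\<lambda>y. c * exp (\<i> * of_real (\<eta> * y))) x
            = Q * (c * exp (\<i> * of_real (\<eta> * x))))"
        unfolding mode_def by blast
    qed
  next
    assume stable: "A_stable k a b \<beta>"
    define \<eta> where "\<eta> = 2 * pi / (b - a)"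
    \<comment> \<open>This solves \<open>\<eta>^2 / (\<theta> + \<eta>^2) = t\<close>; with
      \<open>A = 1\<close> the step \<open>dt\<close> then makes
      \<open>\<alpha>^2 = \<theta>\<close>.\<close>
    define \<theta> where "\<theta> = \<eta>\<^sup>2 * (1 - t) / t"
    define dt where "dt = \<beta> / \<theta>"
    have \<eta>: "\<eta> > 0" using assms by (simp add: \<eta>_def)
    have \<theta>: "\<theta> > 0" using \<eta> t by (simp add: \<theta>_def)
    have dt: "dt > 0" using \<theta> assms by (simp add: dt_def)
    have eq: "\<beta> / (1 * dt) = \<theta>" using assms \<theta> by (simp add: dt_def)
    have "\<theta> + \<eta>\<^sup>2 = \<eta>\<^sup>2 / t"
      using t by (simp add: \<theta>_def field_simps)
    then have st: "\<eta>\<^sup>2 / (\<theta> + \<eta>\<^sup>2) = t"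
      using \<eta> t by simp
    have per: "\<eta> = 2 * pi / (b - a) * of_int 1" by (simp add: \<eta>_def)
    then have "\<exists>m::int. \<eta> = 2 * pi / (b - a) * of_int m" by blast
    then obtain Q where Q: "norm Q \<le> 1"
      "\<forall>c. \<forall>x\<in>{a..b}. euler_step k a b \<beta> 1 dt (mode c \<eta>) x = Q * mode c \<eta> x"
      using stable[unfolded A_stable_def, rule_format, OF dt zero_less_one] unfolding mode_def by blast
    \<comment> \<open>Amplitude 1 gives a nonvanishing mode, so \<open>Q\<close> can be read off at
      the single point \<open>a\<close>.\<close>
    have "Q * mode 1 \<eta> a = of_real (1 - \<beta> * profile k t) * mode 1 \<eta> a"
      using euler_step_mode[OF assms(2,3) dt zero_less_one per, of a k 1] Q(2) assms(2)
      unfolding eq st by simp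
    then have "Q = of_real (1 - \<beta> * profile k t)"
      by (simp add: mode_def)
    then have "\<bar>1 - \<beta> * profile k t\<bar> \<le> 1"
      using Q(1) by (simp only: norm_of_real)
    then have "\<beta> * profile_max k \<le> 2"
      using t(3) by simp
    then show "\<beta> \<le> 2 / profile_max k"
      using pos by (simp add: field_simps)
  qed
qed

section \<open>Numerical bounds on the maximum for \<open>k = 1, 2, 3\<close>\<close>

lemma profile_max_1: "profile_max 1 = 1 / 4"
proof (rule antisym)
  have "profile 1 s \<le> 1 / 4" for s
    using zero_le_power2[of "s - 1/2"] by (simp add: profile_def power2_eq_square algebra_simps)
  then show "profile_max 1 \<le> 1 / 4"
    by (intro profile_max_le) auto
  show "1 / 4 \<le> profile_max 1"
    using profile_le_profile_max[of "1/2" 1] by (simp add: profile_def)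
qed

lemma profile_max_2: "0.61968 \<le> profile_max 2" "profile_max 2 \<le> 0.61969"
proof -
  \<comment> \<open>Completing the square twice; \<open>0.73\<close> approximates \<open>r\<^sup>2 + r/2\<close> at the maximiser
    \<open>r = (1 + sqrt 17) / 8\<close>.\<close>
  have "0.61969 - profile 2 s = (s\<^sup>2 + s/2 - 0.73)\<^sup>2 + 0.21 * (s - 9/14)\<^sup>2 + 3/700000" for s
    by (simp add: profile_def numeral_2_eq_2 lessThan_Suc) (simp add: power2_eq_square field_simps)
  then have "0 \<le> 0.61969 - profile 2 s" for s
    by simp
  then show "profile_max 2 \<le> 0.61969"
    by (intro profile_max_le) auto
  \<comment> \<open>The point \<open>0.64\<close> is the maximiser rounded to two decimals.\<close>
  have "0.61968 \<le> profile 2 0.64"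
    by (simp add: profile_def numeral_2_eq_2 lessThan_Suc power2_eq_square)
  also have "\<dots> \<le> profile_max 2"
    by (intro profile_le_profile_max) auto
  finally show "0.61968 \<le> profile_max 2" .
qed

lemma profile_max_3: "1.0101 \<le> profile_max 3" "profile_max 3 \<le> 1.01012"
proof -
  have sum3: "(\<Sum>p<3. s ^ p) = 1 + s + s\<^sup>2" for s :: real
    by (simp add: eval_nat_numeral lessThan_Suc)
  have "profile 3 s \<le> 1.01012" if s: "0 \<le> s" for s
  proof -
    define t where "t = s - 18/25"
    \<comment> \<open>\<open>18/25\<close> approximates the maximiser; the quotient by \<open>t\<^sup>2\<close> has nonnegative coefficients,
      and its constant term absorbs the small linear remainder.\<close>
    have "1.01012 - profile 3 s = t\<^sup>2 * (s^4 + 61/25 * s^3 + 2497/625 * s\<^sup>2 + 54503/15625 * s)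
        + (152491/78125 * t\<^sup>2 + 23783/9765625 * t + 32017/1953125000)"
      by (simp add: profile_def sum3 t_def) (simp add: power_numeral_reduce field_simps)
    moreover have "0 \<le> t\<^sup>2 * (s^4 + 61/25 * s^3 + 2497/625 * s\<^sup>2 + 54503/15625 * s)"
      using s by simp
    \<comment> \<open>About 1.218 times this square matches the linear term; the leftover multiple
      of \<open>t^2\<close> and the leftover constant are both positive.\<close>
    moreover have "0 \<le> (t + 1/1000)\<^sup>2" "0 \<le> t\<^sup>2"
      by simp_all
    moreover have "(t + 1/1000)\<^sup>2 = t\<^sup>2 + t / 500 + 1 / 1000000"
      by (simp add: power2_eq_square algebra_simps)
    ultimately have "0 \<le> 1.01012 - profile 3 s"
      by linarith
    then show ?thesis
      by simp
  qed
  then show "profile_max 3 \<le> 1.01012"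
    by (intro profile_max_le) auto
  \<comment> \<open>The same approximate maximiser \<open>18/25\<close> as in the upper
    bound.\<close>
  have "1.0101 \<le> profile 3 0.72"
    by (simp add: profile_def sum3) (simp add: power2_eq_square)
  also have "\<dots> \<le> profile_max 3"
    by (intro profile_le_profile_max) auto
  finally show "1.0101 \<le> profile_max 3" .
qed

text \<open>Instability above \<open>\<beta>max k\<close> makes it the exact threshold, hence
  uniquely determined for \<open>k \<ge> 1\<close>; the decimals for \<open>k = 2, 3\<close> are
  therefore stated as approximations.\<close>

theorem theorem3p2:
  shows "\<exists>\<beta>max :: nat \<Rightarrow> real.
    (\<forall>k\<ge>1. \<beta>max k > 0 \<and>
       (\<forall>a b \<beta> :: real. a < b \<longrightarrow> 0 < \<beta> \<longrightarrow> \<beta> \<le> \<beta>max k \<longrightarrow> A_stable k a b \<beta>) \<and>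
       (\<forall>a b \<beta> :: real. a < b \<longrightarrow> \<beta>max k < \<beta> \<longrightarrow> \<not> A_stable k a b \<beta>)) \<and>
    \<beta>max 1 = 8 \<and>
    \<bar>\<beta>max 2 - 3.2275\<bar> < 1 / 10 ^ 4 \<and>
    \<bar>\<beta>max 3 - 1.9800\<bar> < 1 / (2 * 10 ^ 4)"
proof (intro exI[of _ "\<lambda>k. 2 / profile_max k"] conjI allI impI)
  fix k :: nat
  assume k: "k \<ge> 1"
  show pos: "0 < 2 / profile_max k"
    using profile_max_pos[OF k] by simp
  show "A_stable k a b \<beta>" if "a < b" "0 < \<beta>" "\<beta> \<le> 2 / profile_max k" for a b \<beta>
    using A_stable_iff[OF k] that by blast
  show "\<not> A_stable k a b \<beta>" if "a < b" "2 / profile_max k < \<beta>" for a b \<beta>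
    using A_stable_iff[OF k that(1), of \<beta>] pos that(2) by linarith
next
  show "2 / profile_max 1 = 8"
    unfolding profile_max_1 by simp
  \<comment> \<open>The bounds put the quotient between 3.22742 and 3.22748, within one unit of the
    fourth decimal.\<close>
  show "\<bar>2 / profile_max 2 - 3.2275\<bar> < 1 / 10 ^ 4"
    using profile_max_2 unfolding abs_less_iff by (simp add: field_simps)
  show "\<bar>2 / profile_max 3 - 1.9800\<bar> < 1 / (2 * 10 ^ 4)"
    using profile_max_3 unfolding abs_less_iff by (simp add: field_simps)
qed

end
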